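(* Set $r=\sigma_2^2/\sigma_1^2$, $W_1=(X_1-X_2)/(1+r)$, $W_2=(rX_1+X_2)/(1+r)$, $\mu_1=(\theta_1-\theta_2)/(1+r)$. Let $\delta_\psi$ be an estimator of $\theta_1$ of the form $\delta_\psi(W_1,W_2)=W_2+\psi(W_1)$, and let $$\underline{R}=\frac{1}{\sigma_Y^2}\left(\frac{\sigma_1^2\sigma_2^2}{\sigma_1^2+\sigma_2^2}+\frac1p\inf_{\mu_1}\mathbb{E}\big[\|\psi(W_1)-\mu_1\|^2\big]\right),$$ the infimum being over $\mu_1$ with $(1+r)\mu_1\in A$. Then, for estimating the density of $Y_1$ under Kullback-Leibler loss with $\theta_1-\theta_2\in A$, the predictive density $q_{\delta_\psi,c}\sim N_p(\delta_\psi,c\,\sigma_Y^2I_p)$ dominates the plug-in predictive density $q_{\delta_\psi,1}\sim N_p(\delta_\psi,\sigma_Y^2I_p)$ for all $1<c<c_0(1+\underline{R})$. Moreover, $$c_0(1+\underline{R})\ \ge\ (1+\underline{R})^2\ \ge\ \left(1+\frac{1}{\sigma_Y^2}\,\frac{\sigma_1^2\sigma_2^2}{\sigma_1^2+\sigma_2^2}\right)^2.$$ Finally, for the maximum likelihood predictive density estimator $\hat q_{\mathrm{mle}}\sim N_p(\hat\theta_{1,\mathrm{mle}},\sigma_Y^2I_p)$, one has $\hat\theta_{1,\mathrm{mle}}(X)=W_2+\hat\mu_{1,\mathrm{mle}}(W_1)$, and the predictive density $q_{\hat\theta_{1,\mathrm{mle}},c}\sim N_p(\hat\theta_{1,\mathrm{mle}},c\,\sigma_Y^2I_p)$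 dominates $\hat q_{\mathrm{mle}}$ under Kullback-Leibler loss for all $1<c<c_0(1+\underline{R})$, with $c_0(1+\underline{R})\ge(1+\underline{R})^2\ge\left(1+\frac{1}{\sigma_Y^2}\,\frac{\sigma_1^2\sigma_2^2}{\sigma_1^2+\sigma_2^2}\right)^2$, where now $$\underline{R}=\frac{1}{\sigma_Y^2}\left(\frac{\sigma_1^2\sigma_2^2}{\sigma_1^2+\sigma_2^2}+\frac1p\inf_{\mu_1}\mathbb{E}\big[\|\hat\mu_{1,\mathrm{mle}}(W_1)-\mu_1\|^2\big]\right),$$ the infimum being over $\mu_1$ with $(1+r)\mu_1\in A$, and where $\hat\mu_{1,\mathrm{mle}}(W_1)$ is the maximum likelihood estimator of $\mu_1$ based on $W_1\sim N_p\big(\mu_1,\frac{\sigma_1^2}{1+r}I_p\big)$ under the restriction $(1+r)\mu_1\in A$.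
   Context: Model: $X=(X_1,X_2)$ and $Y_1$, with $X_1\sim N_p(\theta_1,\sigma_1^2I_p)$, $X_2\sim N_p(\theta_2,\sigma_2^2I_p)$, $Y_1\sim N_p(\theta_1,\sigma_Y^2I_p)$ independent, where $\sigma_1^2,\sigma_2^2,\sigma_Y^2>0$ are known and $\theta=(\theta_1,\theta_2)\in\mathbb{R}^{2p}$ satisfies $\theta_1-\theta_2\in A$ for a given $A\subset\mathbb{R}^p$. Let $q_{\theta_1}$ be the density of $Y_1$. Kullback-Leibler loss of a predictive density $\hat q(\cdot;x)$ is $\int q_{\theta_1}(y)\log\frac{q_{\theta_1}(y)}{\hat q(y;x)}\,dy$; risk is its expectation under the distribution of $X$ given $\theta$. A predictive density dominates another if its risk is less than or equal for all $\theta$ with $\theta_1-\theta_2\in A$, with strict inequality for at least one such $\theta$. $\hat\theta_{1,\mathrm{mle}}$ denotes the maximum likelihood estimator of $\theta_1$ based on $X$ under the restriction $\theta_1-\theta_2\in A$. For $s>1$, $c_0(s)$ denotes the root $c\in(s,\infty)$ of $G_s(c)=(1-1/c)\,s-\log c$. *)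

theory Defs
  imports "HOL-Probability.Probability"
begin

text \<open>Density and law of the normal distribution with mean \<open>m\<close> and covariance matrix \<open>v\<close> times
  the identity on \<open>real ^ 'p\<close>. The second parameter is the variance, unlike in
  \<^const>\<open>normal_density\<close>.\<close>

definition mvn_density :: "real ^ 'p \<Rightarrow> real \<Rightarrow> real ^ 'p \<Rightarrow> real" where
  "mvn_density m v y = exp (- (norm (y - m))\<^sup>2 / (2 * v)) / sqrt (2 * pi * v) ^ CARD('p)"

definition mvn :: "real ^ 'p \<Rightarrow> real \<Rightarrow> (real ^ 'p) measure" where
  "mvn m v = density lborel (\<lambda>y. ennreal (mvn_density m v y))"

type_synonym 'p pair = "(real ^ 'p) \<times> (real ^ 'p)"

definition X_law :: "real \<Rightarrow> real \<Rightarrow> 'p::finite pair \<Rightarrow> 'p pair measure" where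
  "X_law \<sigma>1 \<sigma>2 \<theta> = mvn (fst \<theta>) (\<sigma>1\<^sup>2) \<Otimes>\<^sub>M mvn (snd \<theta>) (\<sigma>2\<^sup>2)"

definition param_space :: "(real ^ 'p) set \<Rightarrow> 'p::finite pair set" where
  "param_space A = {\<theta>. fst \<theta> - snd \<theta> \<in> A}"


text \<open>A Bochner integral. It is only ever applied to two normal densities, for which the integrand
  is integrable and the value is nonnegative.\<close>

definition kl_loss :: "(real ^ 'p \<Rightarrow> real) \<Rightarrow> (real ^ 'p \<Rightarrow> real) \<Rightarrow> real" where
  "kl_loss q qhat = (\<integral>y. q y * ln (q y / qhat y) \<partial>lborel)"

text \<open>The risk may be infinite, hence the nonnegative integral.\<close>

definition kl_risk ::
  "real \<Rightarrow> real \<Rightarrow> real \<Rightarrow> ('p::finite pair \<Rightarrow> real ^ 'p \<Rightarrow> real) \<Rightarrow> 'p pair \<Rightarrow> ennreal" where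
  "kl_risk \<sigma>1 \<sigma>2 \<sigma>Y qhat \<theta> =
     (\<integral>\<^sup>+x. ennreal (kl_loss (mvn_density (fst \<theta>) (\<sigma>Y\<^sup>2)) (qhat x)) \<partial>X_law \<sigma>1 \<sigma>2 \<theta>)"

definition dominates ::
  "real \<Rightarrow> real \<Rightarrow> real \<Rightarrow> (real ^ 'p) set \<Rightarrow> ('p::finite pair \<Rightarrow> real ^ 'p \<Rightarrow> real) \<Rightarrow>
     ('p pair \<Rightarrow> real ^ 'p \<Rightarrow> real) \<Rightarrow> bool" where
  "dominates \<sigma>1 \<sigma>2 \<sigma>Y A q q' \<longleftrightarrow>
     (\<forall>\<theta>\<in>param_space A. kl_risk \<sigma>1 \<sigma>2 \<sigma>Y q \<theta> \<le> kl_risk \<sigma>1 \<sigma>2 \<sigma>Y q' \<theta>) \<and>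
     (\<exists>\<theta>\<in>param_space A. kl_risk \<sigma>1 \<sigma>2 \<sigma>Y q \<theta> < kl_risk \<sigma>1 \<sigma>2 \<sigma>Y q' \<theta>)"

definition q_pred ::
  "real \<Rightarrow> ('p::finite pair \<Rightarrow> real ^ 'p) \<Rightarrow> real \<Rightarrow> 'p pair \<Rightarrow> real ^ 'p \<Rightarrow> real" where
  "q_pred \<sigma>Y \<delta> c x = mvn_density (\<delta> x) (c * \<sigma>Y\<^sup>2)"


definition G :: "real \<Rightarrow> real \<Rightarrow> real" where
  "G s c = (1 - 1 / c) * s - ln c"

text \<open>Meaningful for \<open>s > 1\<close>, where the root beyond \<open>s\<close> exists and is unique.\<close>

definition c0 :: "real \<Rightarrow> real" where
  "c0 s = (THE c. s < c \<and> G s c = 0)"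


definition W1 :: "real \<Rightarrow> 'p::finite pair \<Rightarrow> real ^ 'p" where
  "W1 r x = (1 / (1 + r)) *\<^sub>R (fst x - snd x)"

definition W2 :: "real \<Rightarrow> 'p::finite pair \<Rightarrow> real ^ 'p" where
  "W2 r x = (1 / (1 + r)) *\<^sub>R (r *\<^sub>R fst x + snd x)"

definition mu1 :: "real \<Rightarrow> 'p::finite pair \<Rightarrow> real ^ 'p" where
  "mu1 r \<theta> = (1 / (1 + r)) *\<^sub>R (fst \<theta> - snd \<theta>)"

definition delta :: "real \<Rightarrow> (real ^ 'p \<Rightarrow> real ^ 'p) \<Rightarrow> 'p::finite pair \<Rightarrow> real ^ 'p" where
  "delta r \<psi> x = W2 r x + \<psi> (W1 r x)"

text \<open>The infimum of the mean squared errors of \<open>\<psi> W1\<close>, where \<open>W1\<close> has law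
  \<open>mvn \<mu> (\<sigma>1\<^sup>2 / (1 + r))\<close>. It is taken in \<^typ>\<open>ennreal\<close>, so that infinite mean squared errors
  do not lower it.\<close>

definition inf_mse ::
  "real \<Rightarrow> real \<Rightarrow> (real ^ 'p) set \<Rightarrow> (real ^ 'p \<Rightarrow> real ^ 'p::finite) \<Rightarrow> ennreal" where
  "inf_mse \<sigma>1 r A \<psi> =
     (INF \<mu>\<in>{\<mu>. (1 + r) *\<^sub>R \<mu> \<in> A}.
        \<integral>\<^sup>+w. ennreal ((norm (\<psi> w - \<mu>))\<^sup>2) \<partial>mvn \<mu> (\<sigma>1\<^sup>2 / (1 + r)))"

text \<open>Meaningful only when \<^const>\<open>inf_mse\<close> is finite.\<close>

definition R_low ::
  "real \<Rightarrow> real \<Rightarrow> real \<Rightarrow> (real ^ 'p) set \<Rightarrow> (real ^ 'p \<Rightarrow> real ^ 'p::finite) \<Rightarrow> real" where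
  "R_low \<sigma>1 \<sigma>2 \<sigma>Y A \<psi> =
     1 / \<sigma>Y\<^sup>2 * (\<sigma>1\<^sup>2 * \<sigma>2\<^sup>2 / (\<sigma>1\<^sup>2 + \<sigma>2\<^sup>2)
        + 1 / real CARD('p) * enn2real (inf_mse \<sigma>1 (\<sigma>2\<^sup>2 / \<sigma>1\<^sup>2) A \<psi>))"


text \<open>For general \<open>A\<close> the maximiser of the likelihood need not be unique, so being a maximum
  likelihood estimate is a relation between observation and estimate. The estimate of \<open>\<theta>1\<close> is the
  first component of a joint maximiser.\<close>

definition is_theta1_mle ::
  "real \<Rightarrow> real \<Rightarrow> (real ^ 'p) set \<Rightarrow> 'p::finite pair \<Rightarrow> real ^ 'p \<Rightarrow> bool" where
  "is_theta1_mle \<sigma>1 \<sigma>2 A x t1 \<longleftrightarrow>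
     (\<exists>t2. is_arg_max
        (\<lambda>\<theta>. mvn_density (fst \<theta>) (\<sigma>1\<^sup>2) (fst x) * mvn_density (snd \<theta>) (\<sigma>2\<^sup>2) (snd x))
        (\<lambda>\<theta>. \<theta> \<in> param_space A) (t1, t2))"

definition is_mu1_mle ::
  "real \<Rightarrow> real \<Rightarrow> (real ^ 'p) set \<Rightarrow> real ^ 'p \<Rightarrow> real ^ 'p::finite \<Rightarrow> bool" where
  "is_mu1_mle \<sigma>1 r A w m \<longleftrightarrow>
     is_arg_max (\<lambda>\<mu>. mvn_density \<mu> (\<sigma>1\<^sup>2 / (1 + r)) w) (\<lambda>\<mu>. (1 + r) *\<^sub>R \<mu> \<in> A) m"

end

theory Submission imports Defs begin

text \<open>For two normal laws the Kullback--Leibler loss is explicit: with \<open>p\<close> the dimension, the loss of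
\<open>N(d, c v I)\<close> at \<open>N(m, v I)\<close> is \<open>p/2 (ln c + 1/c - 1) + |d - m|\<^sup>2 / (2 c v)\<close>
(\<open>kl_loss_mvn\<close>). The risk of the expanded density is therefore affine in the quadratic risk of the
point estimator \<open>\<delta>\<close>. If that quadratic risk is \<open>p \<sigma>Y\<^sup>2 R\<close>, the plug-in risk exceeds the risk at
expansion \<open>c\<close> by exactly \<open>p/2 G (1 + R) c\<close> (\<open>risk_gap_eq_G\<close>).

The coordinates \<open>W1\<close> and \<open>W2\<close> diagonalise the normal law of \<open>X\<close>: they are independent
(\<open>nn_integral_W1_W2\<close>), and the restriction on the parameter concerns only the mean of \<open>W1\<close>.
Hence the quadratic risk of \<open>W2 + \<psi>(W1)\<close> splits into the variance term of \<open>W2\<close>, which does not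
depend on the parameter, plus the mean squared error of \<open>\<psi>(W1)\<close> (\<open>mse_delta\<close>). So \<open>R\<close> is at least
\<open>R_low\<close> for every admissible parameter, and as \<open>G s c\<close> increases with \<open>s\<close>, the risk difference is
positive whenever \<open>G (1 + R_low) c\<close> is. For \<open>s > 1\<close> the function \<open>G s\<close> vanishes at \<open>1\<close>, increases
up to \<open>s\<close> and decreases afterwards, so beyond \<open>1\<close> it is positive exactly up to its second zero \<open>c0 s\<close>; it is
nonnegative at \<open>s\<^sup>2\<close>, which gives \<open>s\<^sup>2 \<le> c0 s\<close>. Where the quadratic risk is infinite, so is the
plug-in risk and there is nothing to compare; finiteness of the infimum supplies a parameter at which
the comparison is strict.

For maximum likelihood, the likelihood factorises along the same coordinates. Its maximisation leaves
\<open>W2\<close> as the estimate of its own mean, and as the estimate of \<open>\<mu>1\<close> a point of the rescaled set \<open>A\<close>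
nearest to \<open>W1\<close> (\<open>is_theta1_mle_iff\<close>). For a nonconvex set a nearest point need not be
unique, so two measurable selections may differ; they differ only on a null set. The nearest-point
correspondence is monotone, so along any line the values of its component in the direction of the line
span intervals with disjoint interiors, of which only countably many can be nondegenerate. A Borel set
that meets every line of a given direction in a countable set is null (\<open>null_set_if_countable_on_lines\<close>). Finally the
nearest point to \<open>w\<close> is at most twice as far from a given point \<open>\<mu>\<close> of the set as \<open>w\<close> is, so its mean squared
error is finite, and the general result applies.\<close>

section \<open>Moments of the isotropic normal law\<close>

lemma real_normal_moments:
  assumes "v > 0"
  shows "has_bochner_integral lborel (normal_density m (sqrt v)) 1"
    and "has_bochner_integral lborel (\<lambda>x. normal_density m (sqrt v) x * (x - a)\<^sup>2) (v + (m - a)\<^sup>2)"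
proof -
  let ?n = "normal_density m (sqrt v)"
  have pos: "0 < sqrt v" using assms by simp
  show zeroth: "has_bochner_integral lborel ?n 1"
    using normal_moment_even[OF pos, of m 0] by simp
  have first: "has_bochner_integral lborel (\<lambda>x. ?n x * (x - m)) 0"
    using normal_moment_odd[OF pos, of m 0] by simp
  have second: "has_bochner_integral lborel (\<lambda>x. ?n x * (x - m)\<^sup>2) v"
    using normal_moment_even[OF pos, of m 1] assms by (simp add: fact_2)
  have "has_bochner_integral lborel
      (\<lambda>x. ?n x * (x - m)\<^sup>2 + (?n x * (x - m)) * (2 * (m - a)) + ?n x * (m - a)\<^sup>2)
      (v + 0 * (2 * (m - a)) + 1 * (m - a)\<^sup>2)"
    by (intro has_bochner_integral_add has_bochner_integral_mult_left zeroth first second)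
  moreover have "?n x * (x - m)\<^sup>2 + (?n x * (x - m)) * (2 * (m - a)) + ?n x * (m - a)\<^sup>2
      = ?n x * (x - a)\<^sup>2" for x
    by (simp add: power2_eq_square algebra_simps)
  ultimately show "has_bochner_integral lborel (\<lambda>x. ?n x * (x - a)\<^sup>2) (v + (m - a)\<^sup>2)"
    by simp
qed

lemma norm_power2_eq_sum_Basis: "(norm (x::'a::euclidean_space))\<^sup>2 = (\<Sum>b\<in>Basis. (x \<bullet> b)\<^sup>2)"
  unfolding power2_norm_eq_inner by (subst euclidean_inner) (simp add: power2_eq_square)

lemma mvn_density_eq_prod:
  fixes m y :: "real ^ 'p::finite"
  assumes "v > 0"
  shows "mvn_density m v y = (\<Prod>b\<in>Basis. normal_density (m \<bullet> b) (sqrt v) (y \<bullet> b))"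
proof -
  have "(\<Prod>b\<in>(Basis :: (real ^ 'p) set). exp (- ((y - m) \<bullet> b)\<^sup>2 / (2 * v)))
      = exp (- (norm (y - m))\<^sup>2 / (2 * v))"
    by (simp add: exp_sum[symmetric] norm_power2_eq_sum_Basis[of "y - m"] sum_negf sum_divide_distrib)
  then show ?thesis
    using assms
    by (simp add: mvn_density_def normal_density_def prod_dividef inner_diff_left power_divide)
qed

text \<open>Lebesgue measure is the product of its coordinate measures, so Tonelli reduces the moments of a product
density to moments on the line. Only nonnegative factors are ever integrated here.\<close>

lemma has_bochner_integral_prod_Basis:
  fixes f :: "'a::euclidean_space \<Rightarrow> real \<Rightarrow> real"
  assumes f: "\<And>b. b \<in> Basis \<Longrightarrow> has_bochner_integral lborel (f b) (I b)"
    and nonneg: "\<And>b x. b \<in> Basis \<Longrightarrow> 0 \<le> f b x"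
  shows "has_bochner_integral lborel (\<lambda>y::'a. \<Prod>b\<in>Basis. f b (y \<bullet> b)) (\<Prod>b\<in>Basis. I b)"
proof (rule has_bochner_integral_nn_integral)
  have meas[measurable]: "f b \<in> borel_measurable borel" if "b \<in> Basis" for b
    using f[OF that] by (auto dest: borel_measurable_has_bochner_integral)
  show "(\<lambda>y::'a. \<Prod>b\<in>Basis. f b (y \<bullet> b)) \<in> borel_measurable lborel"
    by measurable
  show "AE y in lborel. 0 \<le> (\<Prod>b\<in>Basis. f b ((y::'a) \<bullet> b))"
    using nonneg by (auto intro: prod_nonneg)
  have I_nonneg: "0 \<le> I b" if "b \<in> Basis" for b
    using has_bochner_integral_integral_eq[OF f[OF that]] Bochner_Integration.integral_nonneg[of lborel "f b"] nonneg[OF that]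
    by simp
  then show "0 \<le> (\<Prod>b\<in>(Basis :: 'a set). I b)"
    by (intro prod_nonneg) auto
  have int1: "(\<integral>\<^sup>+x. ennreal (f b x) \<partial>lborel) = ennreal (I b)" if "b \<in> Basis" for b
    using f[OF that] nonneg[OF that]
    by (simp add: has_bochner_integral_iff nn_integral_eq_integral)
  have "(\<integral>\<^sup>+y. ennreal (\<Prod>b\<in>Basis. f b ((y::'a) \<bullet> b)) \<partial>lborel)
      = (\<integral>\<^sup>+y. (\<Prod>b\<in>Basis. ennreal (f b ((y::'a) \<bullet> b))) \<partial>lborel)"
    using nonneg by (simp add: prod_ennreal)
  also have "\<dots> = (\<Prod>b\<in>(Basis :: 'a set). (\<integral>\<^sup>+x. ennreal (f b x) \<partial>lborel))"
    by (rule nn_integral_lborel_prod) (auto intro!: measurable_compose[OF meas measurable_ennreal])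
  also have "\<dots> = ennreal (\<Prod>b\<in>Basis. I b)"
    using I_nonneg by (simp add: int1 prod_ennreal)
  finally show "(\<integral>\<^sup>+y. ennreal (\<Prod>b\<in>Basis. f b ((y::'a) \<bullet> b)) \<partial>lborel)
      = ennreal (\<Prod>b\<in>Basis. I b)" .
qed

lemma mvn_density_total:
  fixes m :: "real ^ 'p::finite"
  assumes "v > 0"
  shows "has_bochner_integral lborel (mvn_density m v) 1"
  using has_bochner_integral_prod_Basis
    [of "\<lambda>b. normal_density (m \<bullet> b) (sqrt v)" "\<lambda>_. 1"]
    real_normal_moments(1)[OF assms] mvn_density_eq_prod[OF assms, of m, abs_def]
  by simp

lemma mvn_density_second_moment:
  fixes m a :: "real ^ 'p::finite"
  assumes "v > 0"
  shows "has_bochner_integral lborel (\<lambda>y. mvn_density m v y * (norm (y - a))\<^sup>2)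
    (real CARD('p) * v + (norm (m - a))\<^sup>2)"
proof -
  have coord: "has_bochner_integral lborel (\<lambda>y. mvn_density m v y * ((y - a) \<bullet> j)\<^sup>2)
      (v + ((m - a) \<bullet> j)\<^sup>2)" if j: "j \<in> Basis" for j
  proof -
    \<comment> \<open>the square of one coordinate is itself a product over all coordinates, with factors 1 elsewhere\<close>
    let ?f = "\<lambda>b x. normal_density (m \<bullet> b) (sqrt v) x * (if b = j then (x - a \<bullet> j)\<^sup>2 else 1)"
    let ?I = "\<lambda>b. if b = j then v + (m \<bullet> j - a \<bullet> j)\<^sup>2 else 1"
    have "has_bochner_integral lborel (?f b) (?I b)" for b
      using real_normal_moments[OF assms] by (cases "b = j") auto
    then have "has_bochner_integral lborel (\<lambda>y::real ^ 'p. \<Prod>b\<in>Basis. ?f b (y \<bullet> b)) (\<Prod>b\<in>Basis. ?I b)"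
      by (intro has_bochner_integral_prod_Basis) auto
    then show ?thesis
      using j by (simp add: prod.distrib mvn_density_eq_prod[OF assms] inner_diff_left)
  qed
  have "has_bochner_integral lborel (\<lambda>y. \<Sum>j\<in>Basis. mvn_density m v y * ((y - a) \<bullet> j)\<^sup>2)
      (\<Sum>j\<in>Basis. v + ((m - a) \<bullet> j)\<^sup>2)"
    by (intro has_bochner_integral_sum coord)
  then show ?thesis
    by (simp add: norm_power2_eq_sum_Basis[of "_ - _"] sum.distrib sum_distrib_left)
qed

lemma mvn_density_pos: "v > 0 \<Longrightarrow> 0 < mvn_density m v y"
  by (simp add: mvn_density_def)

lemma mvn_density_measurable [measurable]: "mvn_density m v \<in> borel_measurable borel"
  unfolding mvn_density_def by measurable

lemma sets_mvn [measurable_cong, simp]: "sets (mvn m v) = sets borel"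
  by (simp add: mvn_def)

lemma space_mvn [simp]: "space (mvn m v) = UNIV"
  by (simp add: mvn_def)

lemma nn_integral_mvn:
  "f \<in> borel_measurable borel \<Longrightarrow>
    (\<integral>\<^sup>+y. f y \<partial>mvn m v) = (\<integral>\<^sup>+y. ennreal (mvn_density m v y) * f y \<partial>lborel)"
  by (simp add: mvn_def nn_integral_density)

lemma prob_space_mvn:
  fixes m :: "real ^ 'p::finite"
  assumes "v > 0"
  shows "prob_space (mvn m v)"
proof
  have "(\<integral>\<^sup>+y. ennreal (mvn_density m v y) \<partial>lborel) = 1"
    using mvn_density_total[OF assms, of m] less_imp_le[OF mvn_density_pos[OF assms, of m]]
    by (simp add: has_bochner_integral_iff nn_integral_eq_integral)
  then show "emeasure (mvn m v) (space (mvn m v)) = 1"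
    by (simp add: mvn_def emeasure_density)
qed

lemma nn_integral_mvn_norm2:
  fixes m a :: "real ^ 'p::finite"
  assumes "v > 0"
  shows "(\<integral>\<^sup>+y. ennreal ((norm (y - a))\<^sup>2) \<partial>mvn m v)
    = ennreal (real CARD('p) * v + (norm (m - a))\<^sup>2)"
  using mvn_density_second_moment[OF assms, of m a] less_imp_le[OF mvn_density_pos[OF assms, of m]]
  by (simp add: nn_integral_mvn ennreal_mult[symmetric] has_bochner_integral_iff nn_integral_eq_integral)

text \<open>The log density ratio is a constant plus a difference of two squared distances, and the second moment of
the normal law about an arbitrary centre integrates both.\<close>

lemma kl_loss_mvn:
  fixes m d :: "real ^ 'p::finite"
  assumes v: "v > 0" and c: "c > 0"
  shows "kl_loss (mvn_density m v) (mvn_density d (c * v))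
    = real CARD('p) / 2 * (ln c + 1 / c - 1) + (norm (d - m))\<^sup>2 / (2 * c * v)"
proof -
  let ?q = "mvn_density m v" and ?p = "real CARD('p)"
  have log_ratio: "ln (?q y / mvn_density d (c * v) y)
      = ?p / 2 * ln c - (norm (y - m))\<^sup>2 / (2 * v) + (norm (y - d))\<^sup>2 / (2 * (c * v))" for y
  proof -
    have log_density: "ln (mvn_density a w y) = - (norm (y - a))\<^sup>2 / (2 * w) - ?p * (ln (2 * pi * w) / 2)"
      if "w > 0" for a :: "real ^ 'p" and w
      using that by (simp add: mvn_density_def ln_div ln_realpow ln_sqrt)
    moreover have "ln (2 * pi * (c * v)) = ln c + ln (2 * pi * v)"
      using v c by (simp add: ln_mult)
    moreover have "ln (?q y / mvn_density d (c * v) y) = ln (?q y) - ln (mvn_density d (c * v) y)"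
      using v c by (intro ln_divide_pos mvn_density_pos) auto
    ultimately show ?thesis
      using v c log_density[OF v, of m] log_density[of "c * v" d]
      by (simp add: algebra_simps add_divide_distrib)
  qed
  have "has_bochner_integral lborel
      (\<lambda>y. ?q y * (?p / 2 * ln c) - (?q y * (norm (y - m))\<^sup>2) * (1 / (2 * v))
          + (?q y * (norm (y - d))\<^sup>2) * (1 / (2 * (c * v))))
      (1 * (?p / 2 * ln c) - (?p * v + (norm (m - m))\<^sup>2) * (1 / (2 * v))
          + (?p * v + (norm (m - d))\<^sup>2) * (1 / (2 * (c * v))))"
    by (intro has_bochner_integral_add has_bochner_integral_diff has_bochner_integral_mult_left
        mvn_density_total mvn_density_second_moment v)
  then have "has_bochner_integral lborel (\<lambda>y. ?q y * ln (?q y / mvn_density d (c * v) y))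
      (1 * (?p / 2 * ln c) - (?p * v + (norm (m - m))\<^sup>2) * (1 / (2 * v))
          + (?p * v + (norm (m - d))\<^sup>2) * (1 / (2 * (c * v))))"
    by (simp add: log_ratio algebra_simps)
  then show ?thesis
    using v c unfolding kl_loss_def
    by (simp add: has_bochner_integral_iff norm_minus_commute field_simps)
qed

section \<open>Independence of the coordinates W1 and W2\<close>

lemma nn_integral_lborel_affine:
  fixes f :: "'a::euclidean_space \<Rightarrow> ennreal"
  assumes [measurable]: "f \<in> borel_measurable borel" and k: "k > 0"
  shows "(\<integral>\<^sup>+x. f x \<partial>lborel) = ennreal (k ^ DIM('a)) * (\<integral>\<^sup>+x. f (t + k *\<^sub>R x) \<partial>lborel)"
  using k by (subst lborel_affine[of k t])
    (simp_all add: nn_integral_density nn_integral_distr nn_integral_cmult)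

text \<open>The cross terms \<open>2 (a \<bullet> b) / s\<close> cancel precisely because the ratio of the two variances equals the
coefficient \<open>r\<close> in the change of variables. This is why \<open>W1\<close> and \<open>W2\<close> are
independent, and why the likelihood splits.\<close>

lemma quadratic_form_decomposition:
  fixes a b :: "'a::real_inner"
  assumes s: "s > 0" and r: "r > 0"
  shows "(norm (a + b))\<^sup>2 / s + (norm (b - r *\<^sub>R a))\<^sup>2 / (r * s)
    = (norm a)\<^sup>2 / (s / (1 + r)) + (norm b)\<^sup>2 / (r * s / (1 + r))"
proof -
  have "(norm (a + b))\<^sup>2 = (norm a)\<^sup>2 + 2 * (a \<bullet> b) + (norm b)\<^sup>2"
    by (simp add: power2_norm_eq_inner inner_simps inner_commute)
  moreover have "(norm (b - r *\<^sub>R a))\<^sup>2 = r\<^sup>2 * (norm a)\<^sup>2 - 2 * r * (a \<bullet> b) + (norm b)\<^sup>2"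
    by (simp only: power2_norm_eq_inner) (simp add: inner_simps inner_commute power2_eq_square)
  ultimately show ?thesis
    using s r by (simp add: field_simps power2_eq_square)
qed

lemma mvn_density_decomposition:
  fixes w1 w2 :: "real ^ 'p::finite"
  assumes s: "s > 0" and r: "r > 0"
  shows "(1 + r) ^ CARD('p)
      * (mvn_density (m1 + m2) s (w1 + w2) * mvn_density (m2 - r *\<^sub>R m1) (r * s) (w2 - r *\<^sub>R w1))
    = mvn_density m1 (s / (1 + r)) w1 * mvn_density m2 (r * s / (1 + r)) w2"
proof -
  let ?a = "w1 - m1" and ?b = "w2 - m2"
  have diffs: "w1 + w2 - (m1 + m2) = ?a + ?b"
    "w2 - r *\<^sub>R w1 - (m2 - r *\<^sub>R m1) = ?b - r *\<^sub>R ?a"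
    by (simp_all add: algebra_simps)
  \<comment> \<open>the form of the exponents on which the decomposition of the quadratic form can be rewritten\<close>
  have half: "- x / (2 * v) = (- 1 / 2) * (x / v)" for x v :: real
    by simp
  have exponents: "- (norm (?a + ?b))\<^sup>2 / (2 * s) + - (norm (?b - r *\<^sub>R ?a))\<^sup>2 / (2 * (r * s))
      = - (norm ?a)\<^sup>2 / (2 * (s / (1 + r))) + - (norm ?b)\<^sup>2 / (2 * (r * s / (1 + r)))"
    unfolding half distrib_left[symmetric] quadratic_form_decomposition[OF s r] ..
  have "sqrt (2 * pi * s) * sqrt (2 * pi * (r * s))
      = (1 + r) * (sqrt (2 * pi * (s / (1 + r))) * sqrt (2 * pi * (r * s / (1 + r))))"
    using s r by (simp add: real_sqrt_mult real_sqrt_divide)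
  then have constants: "sqrt (2 * pi * s) ^ CARD('p) * sqrt (2 * pi * (r * s)) ^ CARD('p)
      = (1 + r) ^ CARD('p)
        * (sqrt (2 * pi * (s / (1 + r))) ^ CARD('p) * sqrt (2 * pi * (r * s / (1 + r))) ^ CARD('p))"
    by (simp only: power_mult_distrib[symmetric])
  have combine: "k * (e1 / d1 * (e2 / d2)) = k * (e1 * e2) / (d1 * d2)"
    "e1 / d1 * (e2 / d2) = (e1 * e2) / (d1 * d2)" for k e1 e2 d1 d2 :: real
    by simp_all
  show ?thesis
    unfolding mvn_density_def diffs combine exp_add[symmetric] exponents constants
    using s r by simp
qed

lemma X_law_density:
  fixes \<theta> :: "'p::finite pair"
  assumes "\<sigma>1 > 0" "\<sigma>2 > 0"
  shows "X_law \<sigma>1 \<sigma>2 \<theta> = density (lborel \<Otimes>\<^sub>M lborel)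
    (\<lambda>(x1, x2). ennreal (mvn_density (fst \<theta>) (\<sigma>1\<^sup>2) x1 * mvn_density (snd \<theta>) (\<sigma>2\<^sup>2) x2))"
proof -
  interpret P2: prob_space "mvn (snd \<theta>) (\<sigma>2\<^sup>2)" using assms by (intro prob_space_mvn) simp
  have "sigma_finite_measure (density lborel (\<lambda>y. ennreal (mvn_density (snd \<theta>) (\<sigma>2\<^sup>2) y)))"
    using P2.sigma_finite_measure_axioms by (simp add: mvn_def)
  then show ?thesis
    using assms
    by (simp add: X_law_def mvn_def pair_measure_density lborel.sigma_finite_measure_axioms
        ennreal_mult less_imp_le mvn_density_pos)
qed

lemma nn_integral_X_law:
  fixes \<theta> :: "'p::finite pair"
  assumes [measurable]: "f \<in> borel_measurable (borel \<Otimes>\<^sub>M borel)" and pos: "\<sigma>1 > 0" "\<sigma>2 > 0"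
  shows "(\<integral>\<^sup>+x. f x \<partial>X_law \<sigma>1 \<sigma>2 \<theta>) = (\<integral>\<^sup>+x2. (\<integral>\<^sup>+x1.
      ennreal (mvn_density (fst \<theta>) (\<sigma>1\<^sup>2) x1 * mvn_density (snd \<theta>) (\<sigma>2\<^sup>2) x2) * f (x1, x2)
      \<partial>lborel) \<partial>lborel)"
  by (simp add: X_law_density[OF pos] nn_integral_density lborel_pair.nn_integral_snd[symmetric])

text \<open>The inverse of the change of variables is \<open>(w1, w2) \<mapsto> (w1 + w2, w2 - r w1)\<close>. The same maps act on
parameters, taking the mean of \<open>X\<close> to the means of \<open>W1\<close> and \<open>W2\<close>.\<close>

lemma W_inverse:
  assumes "r > 0"
  shows "W1 r x + W2 r x = fst x" "W2 r x - r *\<^sub>R W1 r x = snd x"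
    "W1 r (w1 + w2, w2 - r *\<^sub>R w1) = w1" "W2 r (w1 + w2, w2 - r *\<^sub>R w1) = w2"
proof -
  have split: "(1 / (1 + r)) *\<^sub>R v + (r / (1 + r)) *\<^sub>R v = v" for v :: "real ^ 'p::finite"
    using assms by (simp add: scaleR_add_left[symmetric] add_divide_distrib[symmetric])
  show "W1 r x + W2 r x = fst x" "W2 r x - r *\<^sub>R W1 r x = snd x"
    "W1 r (w1 + w2, w2 - r *\<^sub>R w1) = w1" "W2 r (w1 + w2, w2 - r *\<^sub>R w1) = w2"
    using split[of "fst x"] split[of "snd x"] split[of w1] split[of w2]
    by (simp_all add: W1_def W2_def algebra_simps)
qed

lemma W_measurable [measurable]:
  "W1 r \<in> borel_measurable (borel \<Otimes>\<^sub>M borel)" "W2 r \<in> borel_measurable (borel \<Otimes>\<^sub>M borel)"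
  unfolding W1_def W2_def by measurable

text \<open>The linear change of variables is carried out as two one-vector substitutions: with \<open>x2\<close> fixed, \<open>x1\<close> is
replaced by \<open>x2 + (1 + r) w1\<close>, which produces the Jacobian \<open>(1 + r) ^ p\<close>; then, with \<open>w1\<close> fixed, \<open>x2\<close>
is translated to \<open>w2 - r w1\<close>. The Jacobian is absorbed by the normalising constants of the
densities. Stating independence through nonnegative integrals covers infinite mean squared errors as
well.\<close>

lemma nn_integral_W1_W2:
  fixes \<theta> :: "'p::finite pair"
  assumes f[measurable]: "f \<in> borel_measurable (borel \<Otimes>\<^sub>M borel)"
    and pos: "\<sigma>1 > 0" "\<sigma>2 > 0" and r: "r = \<sigma>2\<^sup>2 / \<sigma>1\<^sup>2"
  shows "(\<integral>\<^sup>+x. f (W1 r x, W2 r x) \<partial>X_law \<sigma>1 \<sigma>2 \<theta>)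
    = (\<integral>\<^sup>+w1. (\<integral>\<^sup>+w2. f (w1, w2) \<partial>mvn (W2 r \<theta>) (\<sigma>2\<^sup>2 / (1 + r))) \<partial>mvn (mu1 r \<theta>) (\<sigma>1\<^sup>2 / (1 + r)))"
proof -
  let ?v1 = "\<sigma>1\<^sup>2 / (1 + r)" and ?v2 = "\<sigma>2\<^sup>2 / (1 + r)"
  let ?d = "\<lambda>x1 x2. mvn_density (fst \<theta>) (\<sigma>1\<^sup>2) x1 * mvn_density (snd \<theta>) (\<sigma>2\<^sup>2) x2"
  let ?e = "\<lambda>w1 w2. mvn_density (mu1 r \<theta>) ?v1 w1 * mvn_density (W2 r \<theta>) ?v2 w2"
  let ?k = "1 + r"
  have r0: "r > 0" and s2: "\<sigma>2\<^sup>2 = r * \<sigma>1\<^sup>2" and v1: "?v1 > 0" and v2: "?v2 > 0"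
    using pos by (auto simp: r add_pos_pos)
  have \<theta>: "mu1 r \<theta> + W2 r \<theta> = fst \<theta>" "W2 r \<theta> - r *\<^sub>R mu1 r \<theta> = snd \<theta>"
    using W_inverse(1,2)[OF r0, of \<theta>] by (simp_all add: W1_def W2_def mu1_def)
  have dens: "?k ^ CARD('p) * ?d (w1 + w2) (w2 - r *\<^sub>R w1) = ?e w1 w2" for w1 w2
    using mvn_density_decomposition[of "\<sigma>1\<^sup>2" r "mu1 r \<theta>" "W2 r \<theta>" w1 w2] pos r0
    by (simp add: \<theta> s2)
  have "(\<integral>\<^sup>+x. f (W1 r x, W2 r x) \<partial>X_law \<sigma>1 \<sigma>2 \<theta>)
      = (\<integral>\<^sup>+x2. (\<integral>\<^sup>+x1. ennreal (?d x1 x2) * f (W1 r (x1, x2), W2 r (x1, x2)) \<partial>lborel) \<partial>lborel)"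
    by (rule nn_integral_X_law) (use pos in simp_all)
  also have "\<dots> = (\<integral>\<^sup>+x2. ennreal (?k ^ CARD('p)) * (\<integral>\<^sup>+w1. ennreal (?d (x2 + ?k *\<^sub>R w1) x2)
      * f (W1 r (x2 + ?k *\<^sub>R w1, x2), W2 r (x2 + ?k *\<^sub>R w1, x2)) \<partial>lborel) \<partial>lborel)"
  proof (rule nn_integral_cong)
    fix x2 :: "real ^ 'p"
    show "(\<integral>\<^sup>+x1. ennreal (?d x1 x2) * f (W1 r (x1, x2), W2 r (x1, x2)) \<partial>lborel)
        = ennreal (?k ^ CARD('p)) * (\<integral>\<^sup>+w1. ennreal (?d (x2 + ?k *\<^sub>R w1) x2)
          * f (W1 r (x2 + ?k *\<^sub>R w1, x2), W2 r (x2 + ?k *\<^sub>R w1, x2)) \<partial>lborel)"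
      using r0 by (subst nn_integral_lborel_affine[where k = ?k and t = x2]) simp_all
  qed
  also have "\<dots> = (\<integral>\<^sup>+x2. (\<integral>\<^sup>+w1. ennreal (?k ^ CARD('p)) * (ennreal (?d (x2 + ?k *\<^sub>R w1) x2)
      * f (W1 r (x2 + ?k *\<^sub>R w1, x2), W2 r (x2 + ?k *\<^sub>R w1, x2))) \<partial>lborel) \<partial>lborel)"
    by (simp add: nn_integral_cmult)
  also have "\<dots> = (\<integral>\<^sup>+w1. (\<integral>\<^sup>+x2. ennreal (?k ^ CARD('p)) * (ennreal (?d (x2 + ?k *\<^sub>R w1) x2)
      * f (W1 r (x2 + ?k *\<^sub>R w1, x2), W2 r (x2 + ?k *\<^sub>R w1, x2))) \<partial>lborel) \<partial>lborel)"
    by (rule lborel_pair.Fubini') simp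
  also have "\<dots> = (\<integral>\<^sup>+w1. (\<integral>\<^sup>+w2. ennreal (?e w1 w2) * f (w1, w2) \<partial>lborel) \<partial>lborel)"
  proof (rule nn_integral_cong)
    fix w1 :: "real ^ 'p"
    let ?g = "\<lambda>x2. ennreal (?k ^ CARD('p)) * (ennreal (?d (x2 + ?k *\<^sub>R w1) x2)
        * f (W1 r (x2 + ?k *\<^sub>R w1, x2), W2 r (x2 + ?k *\<^sub>R w1, x2)))"
    have "(\<integral>\<^sup>+x2. ?g x2 \<partial>lborel) = (\<integral>\<^sup>+w2. ?g (- (r *\<^sub>R w1) + 1 *\<^sub>R w2) \<partial>lborel)"
      by (subst nn_integral_lborel_affine[where k = 1 and t = "- (r *\<^sub>R w1)"]) simp_all
    also have "\<dots> = (\<integral>\<^sup>+w2. ennreal (?e w1 w2) * f (w1, w2) \<partial>lborel)"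
    proof (rule nn_integral_cong)
      fix w2 :: "real ^ 'p"
      have x2: "- (r *\<^sub>R w1) + 1 *\<^sub>R w2 = w2 - r *\<^sub>R w1"
        and x1: "w2 - r *\<^sub>R w1 + ?k *\<^sub>R w1 = w1 + w2"
        by (simp_all add: algebra_simps)
      show "?g (- (r *\<^sub>R w1) + 1 *\<^sub>R w2) = ennreal (?e w1 w2) * f (w1, w2)"
        unfolding x2 x1 W_inverse(3,4)[OF r0] mult.assoc[symmetric] dens[symmetric]
        using r0 pos by (simp add: ennreal_mult less_imp_le mvn_density_pos mult.assoc)
    qed
    finally show "(\<integral>\<^sup>+x2. ?g x2 \<partial>lborel) = (\<integral>\<^sup>+w2. ennreal (?e w1 w2) * f (w1, w2) \<partial>lborel)" .
  qed
  also have "\<dots> = (\<integral>\<^sup>+w1. (\<integral>\<^sup>+w2. f (w1, w2) \<partial>mvn (W2 r \<theta>) ?v2) \<partial>mvn (mu1 r \<theta>) ?v1)"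
    using v1 v2
    by (simp add: nn_integral_mvn nn_integral_cmult[symmetric] ennreal_mult less_imp_le mvn_density_pos mult.assoc)
  finally show ?thesis .
qed

lemma distr_W1:
  fixes \<theta> :: "'p::finite pair"
  assumes pos: "\<sigma>1 > 0" "\<sigma>2 > 0" and r: "r = \<sigma>2\<^sup>2 / \<sigma>1\<^sup>2"
  shows "distr (X_law \<sigma>1 \<sigma>2 \<theta>) borel (W1 r) = mvn (mu1 r \<theta>) (\<sigma>1\<^sup>2 / (1 + r))"
proof (rule measure_eqI)
  fix B assume "B \<in> sets (distr (X_law \<sigma>1 \<sigma>2 \<theta>) borel (W1 r))"
  then have B[measurable]: "B \<in> sets borel" by simp
  interpret P2: prob_space "mvn (W2 r \<theta>) (\<sigma>2\<^sup>2 / (1 + r))"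
    using pos by (intro prob_space_mvn) (simp add: r add_pos_pos)
  have [measurable]: "W1 r \<in> borel_measurable (X_law \<sigma>1 \<sigma>2 \<theta>)"
    unfolding X_law_def by simp
  have "emeasure (distr (X_law \<sigma>1 \<sigma>2 \<theta>) borel (W1 r)) B
      = (\<integral>\<^sup>+y. indicator B y \<partial>distr (X_law \<sigma>1 \<sigma>2 \<theta>) borel (W1 r))"
    by simp
  also have "\<dots> = (\<integral>\<^sup>+x. indicator B (fst (W1 r x, W2 r x)) \<partial>X_law \<sigma>1 \<sigma>2 \<theta>)"
    by (subst nn_integral_distr) simp_all
  also have "\<dots> = (\<integral>\<^sup>+w1. indicator B w1 \<partial>mvn (mu1 r \<theta>) (\<sigma>1\<^sup>2 / (1 + r)))"
    using P2.emeasure_space_1 by (subst nn_integral_W1_W2[OF _ pos r]) simp_all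
  finally show "emeasure (distr (X_law \<sigma>1 \<sigma>2 \<theta>) borel (W1 r)) B
      = emeasure (mvn (mu1 r \<theta>) (\<sigma>1\<^sup>2 / (1 + r))) B"
    by simp
qed simp

section \<open>The function G and its second zero\<close>

lemma G_at_1 [simp]: "G s 1 = 0"
  by (simp add: G_def)

lemma G_deriv: "c > 0 \<Longrightarrow> ((\<lambda>c. G s c) has_real_derivative (s - c) / c\<^sup>2) (at c)"
  unfolding G_def
  by (auto intro!: derivative_eq_intros simp: field_simps power2_eq_square)

lemma G_strict_increasing:
  assumes "0 < a" "a < b" "b \<le> s"
  shows "G s a < G s b"
proof (rule DERIV_pos_imp_increasing_open[OF assms(2)])
  show "\<exists>y. DERIV (G s) x :> y \<and> 0 < y" if "a < x" "x < b" for x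
    using that assms G_deriv[of x s] by (intro exI[of _ "(s - x) / x\<^sup>2"]) auto
  show "continuous_on {a..b} (G s)"
    unfolding G_def using assms by (intro continuous_intros) auto
qed

lemma G_strict_decreasing:
  assumes "0 < s" "s \<le> a" "a < b"
  shows "G s b < G s a"
proof (rule DERIV_neg_imp_decreasing_open[OF assms(3)])
  show "\<exists>y. DERIV (G s) x :> y \<and> y < 0" if "a < x" "x < b" for x
    using that assms G_deriv[of x s] by (intro exI[of _ "(s - x) / x\<^sup>2"]) (auto simp: divide_neg_pos)
  show "continuous_on {a..b} (G s)"
    unfolding G_def using assms by (intro continuous_intros) auto
qed

text \<open>\<open>G s\<close> is positive at its maximum \<open>s\<close> and at most \<open>0\<close> at \<open>exp s\<close>, where the logarithm alone equals
\<open>s\<close>; strict decrease beyond \<open>s\<close> makes the zero in between unique.\<close>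

lemma c0_root:
  assumes s: "s > 1"
  shows "s < c0 s" "G s (c0 s) = 0"
proof -
  have G_s: "0 < G s s"
    using G_strict_increasing[of 1 s s] s by simp
  have exp_s: "s < exp s"
    using exp_ge_add_one_self[of s] by linarith
  have "G s (exp s) \<le> 0"
    using s by (simp add: G_def algebra_simps)
  moreover have "continuous_on {s..exp s} (G s)"
    unfolding G_def using s by (intro continuous_intros) auto
  ultimately obtain c where c: "s \<le> c" "G s c = 0"
    using IVT2'[of "G s" "exp s" 0 s] G_s exp_s by auto
  have "s < c"
    using c G_s by (cases "s = c") auto
  moreover have "c' = c" if "s < c'" "G s c' = 0" for c'
    using G_strict_decreasing[of s c c'] G_strict_decreasing[of s c' c] c that s
    by (cases c c' rule: linorder_cases) auto
  ultimately have "s < c0 s \<and> G s (c0 s) = 0"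
    unfolding c0_def using c(2) by (intro theI[of "\<lambda>c. s < c \<and> G s c = 0" c]) blast+
  then show "s < c0 s" "G s (c0 s) = 0" by auto
qed

lemma G_pos_below_c0:
  assumes "s > 1" "1 < c" "c < c0 s"
  shows "0 < G s c"
proof (cases "c \<le> s")
  case True
  then show ?thesis using G_strict_increasing[of 1 c s] assms by simp
next
  case False
  then show ?thesis using G_strict_decreasing[of s c "c0 s"] c0_root[of s] assms by simp
qed

text \<open>Substituting \<open>s\<^sup>2\<close> gives \<open>s - 1/s - 2 ln s\<close>, which vanishes at \<open>1\<close> and has derivative
\<open>(1 - 1/s)\<^sup>2\<close>.\<close>

lemma G_square_nonneg:
  assumes "s \<ge> 1"
  shows "0 \<le> G s (s\<^sup>2)"
proof -
  let ?h = "\<lambda>x::real. x - 1 / x - 2 * ln x"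
  have "?h 1 \<le> ?h s"
  proof (rule DERIV_nonneg_imp_nondecreasing[OF assms])
    fix x :: real assume x: "1 \<le> x" "x \<le> s"
    have "DERIV ?h x :> (1 - 1 / x)\<^sup>2"
      using x by (auto intro!: derivative_eq_intros simp: field_simps power2_eq_square)
    then show "\<exists>y. DERIV ?h x :> y \<and> 0 \<le> y" by (auto intro!: exI[of _ "(1 - 1 / x)\<^sup>2"])
  qed
  moreover have "G s (s\<^sup>2) = ?h s"
    using assms by (simp add: G_def ln_realpow) (simp add: field_simps power2_eq_square)
  ultimately show ?thesis by simp
qed

lemma c0_ge_square:
  assumes s: "s > 1"
  shows "s\<^sup>2 \<le> c0 s"
proof (rule ccontr)
  assume "\<not> s\<^sup>2 \<le> c0 s"
  then have "G s (s\<^sup>2) < G s (c0 s)"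
    using c0_root[OF s] s by (intro G_strict_decreasing) auto
  then show False
    using G_square_nonneg[of s] c0_root[OF s] s by simp
qed

lemma mono_G_in_s: "s \<le> t \<Longrightarrow> 1 \<le> c \<Longrightarrow> G s c \<le> G t c"
  by (auto simp: G_def intro!: mult_left_mono)

text \<open>The plug-in risk minus the risk at expansion \<open>c\<close>, for an estimator whose quadratic risk is
\<open>p b + M\<close>; here \<open>y\<close> is the variance of the predicted variable.\<close>

lemma risk_gap_eq_G:
  fixes p y c b M :: real
  assumes "p > 0" "y > 0" "c > 0"
  shows "1 / (2 * y) * (p * b + M) - (p / 2 * (ln c + 1 / c - 1) + 1 / (2 * c * y) * (p * b + M))
    = p / 2 * G (1 + 1 / y * (b + 1 / p * M)) c"
  using assms unfolding G_def by (simp add: field_simps)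

section \<open>Risk comparison\<close>

lemma kl_risk_q_pred:
  fixes \<delta> :: "'p::finite pair \<Rightarrow> real ^ 'p"
  assumes \<delta>[measurable]: "\<delta> \<in> borel_measurable (borel \<Otimes>\<^sub>M borel)"
    and pos: "\<sigma>1 > 0" "\<sigma>2 > 0" "\<sigma>Y > 0" and c: "c \<ge> 1"
  shows "kl_risk \<sigma>1 \<sigma>2 \<sigma>Y (q_pred \<sigma>Y \<delta> c) \<theta>
    = ennreal (real CARD('p) / 2 * (ln c + 1 / c - 1))
      + ennreal (1 / (2 * c * \<sigma>Y\<^sup>2)) * (\<integral>\<^sup>+x. ennreal ((norm (\<delta> x - fst \<theta>))\<^sup>2) \<partial>X_law \<sigma>1 \<sigma>2 \<theta>)"
proof -
  interpret P1: prob_space "mvn (fst \<theta>) (\<sigma>1\<^sup>2)" using pos by (intro prob_space_mvn) simp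
  interpret P2: prob_space "mvn (snd \<theta>) (\<sigma>2\<^sup>2)" using pos by (intro prob_space_mvn) simp
  interpret pair_prob_space "mvn (fst \<theta>) (\<sigma>1\<^sup>2)" "mvn (snd \<theta>) (\<sigma>2\<^sup>2)" ..
  have X: "emeasure (X_law \<sigma>1 \<sigma>2 \<theta>) (space (X_law \<sigma>1 \<sigma>2 \<theta>)) = 1"
    unfolding X_law_def by (rule emeasure_space_1)
  have [measurable]: "\<delta> \<in> borel_measurable (X_law \<sigma>1 \<sigma>2 \<theta>)"
    unfolding X_law_def by simp
  have "ln (1 / c) \<le> 1 / c - 1"
    using c by (intro ln_le_minus_one) simp
  then have K: "0 \<le> real CARD('p) / 2 * (ln c + 1 / c - 1)"
    using c by (simp add: ln_div)
  have "ennreal (kl_loss (mvn_density (fst \<theta>) (\<sigma>Y\<^sup>2)) (q_pred \<sigma>Y \<delta> c x))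
      = ennreal (real CARD('p) / 2 * (ln c + 1 / c - 1))
        + ennreal (1 / (2 * c * \<sigma>Y\<^sup>2)) * ennreal ((norm (\<delta> x - fst \<theta>))\<^sup>2)" for x
    using K c pos by (simp add: q_pred_def kl_loss_mvn ennreal_plus[symmetric] ennreal_mult[symmetric]
        del: ennreal_plus)
  then show ?thesis
    unfolding kl_risk_def by (simp add: nn_integral_add nn_integral_cmult X)
qed

definition mse :: "real \<Rightarrow> real \<Rightarrow> (real ^ 'p \<Rightarrow> real ^ 'p::finite) \<Rightarrow> real ^ 'p \<Rightarrow> ennreal" where
  "mse \<sigma>1 r \<psi> \<mu> = (\<integral>\<^sup>+w. ennreal ((norm (\<psi> w - \<mu>))\<^sup>2) \<partial>mvn \<mu> (\<sigma>1\<^sup>2 / (1 + r)))"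

lemma delta_measurable:
  assumes [measurable]: "\<psi> \<in> borel_measurable borel"
  shows "delta r \<psi> \<in> borel_measurable (borel \<Otimes>\<^sub>M borel)"
  unfolding delta_def by measurable

text \<open>Conditionally on \<open>W1\<close>, the error is \<open>W2\<close> minus a constant, and the second moment about that constant is
the total variance plus the squared distance of the constant to the mean of \<open>W2\<close>. That distance is the
error of \<open>\<psi>(W1)\<close> as an estimate of \<open>\<mu>1\<close>, since the two means add up to \<open>\<theta>1\<close>.\<close>

lemma mse_delta:
  fixes \<theta> :: "'p::finite pair"
  assumes \<psi>[measurable]: "\<psi> \<in> borel_measurable borel"
    and pos: "\<sigma>1 > 0" "\<sigma>2 > 0" and r: "r = \<sigma>2\<^sup>2 / \<sigma>1\<^sup>2"
  shows "(\<integral>\<^sup>+x. ennreal ((norm (delta r \<psi> x - fst \<theta>))\<^sup>2) \<partial>X_law \<sigma>1 \<sigma>2 \<theta>)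
    = ennreal (real CARD('p) * (\<sigma>1\<^sup>2 * \<sigma>2\<^sup>2 / (\<sigma>1\<^sup>2 + \<sigma>2\<^sup>2))) + mse \<sigma>1 r \<psi> (mu1 r \<theta>)"
proof -
  let ?v1 = "\<sigma>1\<^sup>2 / (1 + r)" and ?v2 = "\<sigma>2\<^sup>2 / (1 + r)"
  have r0: "r > 0" using pos by (simp add: r)
  have v: "?v1 > 0" "?v2 > 0" using pos r0 by auto
  have v2: "\<sigma>1\<^sup>2 * \<sigma>2\<^sup>2 / (\<sigma>1\<^sup>2 + \<sigma>2\<^sup>2) = ?v2"
    using pos by (simp add: r field_simps add_pos_pos)
  interpret P1: prob_space "mvn (mu1 r \<theta>) ?v1" using v by (intro prob_space_mvn)
  have \<theta>: "mu1 r \<theta> + W2 r \<theta> = fst \<theta>"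
    using W_inverse(1)[OF r0, of \<theta>] by (simp add: W1_def W2_def mu1_def)
  have "(\<integral>\<^sup>+x. ennreal ((norm (delta r \<psi> x - fst \<theta>))\<^sup>2) \<partial>X_law \<sigma>1 \<sigma>2 \<theta>)
      = (\<integral>\<^sup>+x. (\<lambda>(w1, w2). ennreal ((norm (w2 - (fst \<theta> - \<psi> w1)))\<^sup>2)) (W1 r x, W2 r x) \<partial>X_law \<sigma>1 \<sigma>2 \<theta>)"
    by (simp add: delta_def algebra_simps)
  also have "\<dots> = (\<integral>\<^sup>+w1. (\<integral>\<^sup>+w2. ennreal ((norm (w2 - (fst \<theta> - \<psi> w1)))\<^sup>2)
      \<partial>mvn (W2 r \<theta>) ?v2) \<partial>mvn (mu1 r \<theta>) ?v1)"
    by (subst nn_integral_W1_W2[OF _ pos r]) simp_all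
  also have "\<dots> = (\<integral>\<^sup>+w1. ennreal (real CARD('p) * ?v2) + ennreal ((norm (\<psi> w1 - mu1 r \<theta>))\<^sup>2)
      \<partial>mvn (mu1 r \<theta>) ?v1)"
  proof (rule nn_integral_cong)
    fix w1 :: "real ^ 'p"
    have diff: "W2 r \<theta> - (fst \<theta> - \<psi> w1) = \<psi> w1 - mu1 r \<theta>"
      by (simp add: \<theta>[symmetric])
    show "(\<integral>\<^sup>+w2. ennreal ((norm (w2 - (fst \<theta> - \<psi> w1)))\<^sup>2) \<partial>mvn (W2 r \<theta>) ?v2)
        = ennreal (real CARD('p) * ?v2) + ennreal ((norm (\<psi> w1 - mu1 r \<theta>))\<^sup>2)"
      unfolding nn_integral_mvn_norm2[OF v(2)] diff using v(2) by (simp del: times_divide_eq_right)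
  qed
  also have "\<dots> = ennreal (real CARD('p) * ?v2) + mse \<sigma>1 r \<psi> (mu1 r \<theta>)"
    using P1.emeasure_space_1 by (simp add: mse_def nn_integral_add)
  finally show ?thesis by (simp add: v2)
qed

lemma inf_mse_eq: "inf_mse \<sigma>1 r A \<psi> = (INF \<mu>\<in>{\<mu>. (1 + r) *\<^sub>R \<mu> \<in> A}. mse \<sigma>1 r \<psi> \<mu>)"
  by (simp add: inf_mse_def mse_def)

lemma param_space_mu1:
  assumes "r > 0"
  shows "mu1 r ` param_space A = {\<mu>. (1 + r) *\<^sub>R \<mu> \<in> A}"
proof (intro subset_antisym subsetI)
  fix \<mu> assume "\<mu> \<in> {\<mu>. (1 + r) *\<^sub>R \<mu> \<in> A}"
  then show "\<mu> \<in> mu1 r ` param_space A"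
    using assms by (intro image_eqI[of _ _ "((1 + r) *\<^sub>R \<mu>, 0)"]) (auto simp: mu1_def param_space_def)
qed (use assms in \<open>auto simp: mu1_def param_space_def\<close>)

lemma R_low_bounds:
  fixes A :: "(real ^ 'p::finite) set" and \<psi> :: "real ^ 'p \<Rightarrow> real ^ 'p"
  assumes pos: "\<sigma>1 > 0" "\<sigma>2 > 0" "\<sigma>Y > 0"
  defines "R \<equiv> R_low \<sigma>1 \<sigma>2 \<sigma>Y A \<psi>" and "b \<equiv> 1 / \<sigma>Y\<^sup>2 * (\<sigma>1\<^sup>2 * \<sigma>2\<^sup>2 / (\<sigma>1\<^sup>2 + \<sigma>2\<^sup>2))"
  shows "0 < R" "(1 + b)\<^sup>2 \<le> (1 + R)\<^sup>2" "(1 + R)\<^sup>2 \<le> c0 (1 + R)"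
proof -
  have b: "0 < b"
    using pos by (simp add: b_def add_pos_pos)
  have bR: "b \<le> R"
    unfolding b_def R_def R_low_def using pos by (intro mult_left_mono) auto
  show "0 < R" using b bR by simp
  show "(1 + b)\<^sup>2 \<le> (1 + R)\<^sup>2" using b bR by (intro power_mono) auto
  show "(1 + R)\<^sup>2 \<le> c0 (1 + R)" using b bR by (intro c0_ge_square) simp
qed

text \<open>At parameters with finite mean squared error the strict inequality holds, because the gap is a positive
multiple of \<open>G s c\<close> with \<open>s\<close> no smaller than \<open>1 + R_low\<close>. Such a parameter exists as the
infimum is finite; at all other parameters the plug-in risk is infinite.\<close>

lemma delta_dominates:
  fixes A :: "(real ^ 'p::finite) set"
  assumes pos: "\<sigma>1 > 0" "\<sigma>2 > 0" "\<sigma>Y > 0" and r: "r = \<sigma>2\<^sup>2 / \<sigma>1\<^sup>2"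
    and \<psi>: "\<psi> \<in> borel_measurable borel" and fin: "inf_mse \<sigma>1 r A \<psi> < \<infinity>"
    and c: "1 < c" "c < c0 (1 + R_low \<sigma>1 \<sigma>2 \<sigma>Y A \<psi>)"
  shows "dominates \<sigma>1 \<sigma>2 \<sigma>Y A (q_pred \<sigma>Y (delta r \<psi>) c) (q_pred \<sigma>Y (delta r \<psi>) 1)"
proof -
  let ?p = "real CARD('p)" and ?b = "\<sigma>1\<^sup>2 * \<sigma>2\<^sup>2 / (\<sigma>1\<^sup>2 + \<sigma>2\<^sup>2)"
  let ?R = "R_low \<sigma>1 \<sigma>2 \<sigma>Y A \<psi>" and ?risk = "\<lambda>c. kl_risk \<sigma>1 \<sigma>2 \<sigma>Y (q_pred \<sigma>Y (delta r \<psi>) c)"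
  have r0: "r > 0" using pos by (simp add: r)
  have b0: "0 < ?b" using pos by (simp add: add_pos_pos)
  have risk: "?risk c \<theta> = ennreal (?p / 2 * (ln c + 1 / c - 1))
      + ennreal (1 / (2 * c * \<sigma>Y\<^sup>2)) * (ennreal (?p * ?b) + mse \<sigma>1 r \<psi> (mu1 r \<theta>))"
    if "c \<ge> 1" for c \<theta>
    unfolding kl_risk_q_pred[OF delta_measurable[OF \<psi>] pos that] mse_delta[OF \<psi> pos(1,2) r] ..
  have finite_case: "?risk c \<theta> < ?risk 1 \<theta>"
    if \<theta>: "\<theta> \<in> param_space A" and finite: "mse \<sigma>1 r \<psi> (mu1 r \<theta>) < \<infinity>" for \<theta>
  proof -
    obtain M where M: "mse \<sigma>1 r \<psi> (mu1 r \<theta>) = ennreal M" "0 \<le> M"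
      using finite by (cases "mse \<sigma>1 r \<psi> (mu1 r \<theta>)") auto
    have "inf_mse \<sigma>1 r A \<psi> \<le> ennreal M"
      unfolding inf_mse_eq M(1)[symmetric]
      using \<theta> param_space_mu1[OF r0, of A] by (intro INF_lower) auto
    then have "enn2real (inf_mse \<sigma>1 r A \<psi>) \<le> M"
      using M(2) by (metis enn2real_ennreal enn2real_mono ennreal_less_top infinity_ennreal_def)
    then have "?R \<le> 1 / \<sigma>Y\<^sup>2 * (?b + 1 / ?p * M)"
      unfolding R_low_def r[symmetric] using pos
      by (intro mult_left_mono add_left_mono) auto
    then have "G (1 + ?R) c \<le> G (1 + 1 / \<sigma>Y\<^sup>2 * (?b + 1 / ?p * M)) c"
      using c by (intro mono_G_in_s) auto
    moreover have "0 < G (1 + ?R) c"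
      using R_low_bounds(1)[OF pos, of A \<psi>] c by (intro G_pos_below_c0) auto
    ultimately have G_pos: "0 < G (1 + 1 / \<sigma>Y\<^sup>2 * (?b + 1 / ?p * M)) c"
      by linarith
    have "1 / (2 * \<sigma>Y\<^sup>2) * (?p * ?b + M)
        - (?p / 2 * (ln c + 1 / c - 1) + 1 / (2 * c * \<sigma>Y\<^sup>2) * (?p * ?b + M))
        = ?p / 2 * G (1 + 1 / \<sigma>Y\<^sup>2 * (?b + 1 / ?p * M)) c"
      using pos c by (intro risk_gap_eq_G) auto
    moreover have "0 < ?p / 2 * G (1 + 1 / \<sigma>Y\<^sup>2 * (?b + 1 / ?p * M)) c"
      using G_pos by simp
    ultimately have less: "?p / 2 * (ln c + 1 / c - 1) + 1 / (2 * c * \<sigma>Y\<^sup>2) * (?p * ?b + M)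
        < 1 / (2 * \<sigma>Y\<^sup>2) * (?p * ?b + M)"
      by linarith
    have "ln (1 / c) \<le> 1 / c - 1"
      using c by (intro ln_le_minus_one) simp
    then have K: "0 \<le> ?p / 2 * (ln c + 1 / c - 1)"
      using c by (simp add: ln_div)
    have S: "0 < ?p * ?b + M" using b0 M(2) by (intro add_pos_nonneg mult_pos_pos) auto
    have "?risk c \<theta> = ennreal (?p / 2 * (ln c + 1 / c - 1) + 1 / (2 * c * \<sigma>Y\<^sup>2) * (?p * ?b + M))"
      using c K S M b0 by (simp add: risk ennreal_plus[symmetric] ennreal_mult[symmetric] del: ennreal_plus)
    moreover have "?risk 1 \<theta> = ennreal (1 / (2 * \<sigma>Y\<^sup>2) * (?p * ?b + M))"
      using S M b0 by (simp add: risk ennreal_plus[symmetric] ennreal_mult[symmetric] del: ennreal_plus)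
    moreover have "0 < 1 / (2 * \<sigma>Y\<^sup>2) * (?p * ?b + M)"
      using S pos by (intro mult_pos_pos) auto
    ultimately show ?thesis
      using less by (simp only: ennreal_lessI)
  qed
  have "?risk c \<theta> \<le> ?risk 1 \<theta>" if "\<theta> \<in> param_space A" for \<theta>
  proof (cases "mse \<sigma>1 r \<psi> (mu1 r \<theta>) < \<infinity>")
    case True
    then show ?thesis using finite_case[OF that] by simp
  next
    case False
    then have "mse \<sigma>1 r \<psi> (mu1 r \<theta>) = \<infinity>"
      by (simp add: less_top[symmetric])
    then have "?risk 1 \<theta> = \<infinity>"
      using pos by (simp add: risk ennreal_mult_top)
    then show ?thesis by simp
  qed
  moreover have "\<exists>\<theta>\<in>param_space A. ?risk c \<theta> < ?risk 1 \<theta>"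
  proof -
    obtain \<mu> where "(1 + r) *\<^sub>R \<mu> \<in> A" "mse \<sigma>1 r \<psi> \<mu> < \<infinity>"
      using fin unfolding inf_mse_eq by (auto simp: INF_less_iff)
    then obtain \<theta> where "\<theta> \<in> param_space A" "mse \<sigma>1 r \<psi> (mu1 r \<theta>) < \<infinity>"
      using param_space_mu1[OF r0, of A] by (metis (mono_tags, lifting) imageE mem_Collect_eq)
    then show ?thesis using finite_case by blast
  qed
  ultimately show ?thesis by (simp add: dominates_def)
qed

section \<open>Maximum likelihood as a nearest point\<close>

lemma mvn_density_le_iff:
  fixes m m' y :: "real ^ 'p::finite"
  assumes "v > 0"
  shows "mvn_density m v y \<le> mvn_density m' v y \<longleftrightarrow> norm (y - m') \<le> norm (y - m)"
proof -
  have "mvn_density m v y \<le> mvn_density m' v y \<longleftrightarrow> (norm (y - m'))\<^sup>2 \<le> (norm (y - m))\<^sup>2"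
    using assms pi_gt_zero
    by (simp add: mvn_density_def divide_le_cancel mult_less_0_iff not_less less_imp_le)
  then show ?thesis by (simp add: power2_le_iff_abs_le)
qed

lemma likelihood_factorization:
  fixes x \<theta> :: "'p::finite pair"
  assumes pos: "\<sigma>1 > 0" "\<sigma>2 > 0" and r: "r = \<sigma>2\<^sup>2 / \<sigma>1\<^sup>2"
  shows "(1 + r) ^ CARD('p)
      * (mvn_density (fst \<theta>) (\<sigma>1\<^sup>2) (fst x) * mvn_density (snd \<theta>) (\<sigma>2\<^sup>2) (snd x))
    = mvn_density (mu1 r \<theta>) (\<sigma>1\<^sup>2 / (1 + r)) (W1 r x) * mvn_density (W2 r \<theta>) (\<sigma>2\<^sup>2 / (1 + r)) (W2 r x)"
proof -
  have r0: "r > 0" and s2: "r * \<sigma>1\<^sup>2 = \<sigma>2\<^sup>2" using pos by (auto simp: r)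
  have "mu1 r \<theta> = W1 r \<theta>" by (simp add: mu1_def W1_def)
  then show ?thesis
    using mvn_density_decomposition[of "\<sigma>1\<^sup>2" r "W1 r \<theta>" "W2 r \<theta>" "W1 r x" "W2 r x"] pos r0
    by (simp add: W_inverse[OF r0] s2)
qed

definition nearest_point :: "'a::metric_space set \<Rightarrow> 'a \<Rightarrow> 'a \<Rightarrow> bool" where
  "nearest_point S w m \<longleftrightarrow> m \<in> S \<and> (\<forall>y\<in>S. dist w m \<le> dist w y)"

lemma is_mu1_mle_iff_nearest_point:
  fixes A :: "(real ^ 'p::finite) set"
  assumes "\<sigma>1 > 0" "r > 0"
  shows "is_mu1_mle \<sigma>1 r A w m \<longleftrightarrow> nearest_point {\<mu>. (1 + r) *\<^sub>R \<mu> \<in> A} w m"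
proof -
  have "\<sigma>1\<^sup>2 / (1 + r) > 0" using assms by simp
  then show ?thesis
    by (auto simp: is_mu1_mle_def is_arg_max_linorder nearest_point_def mvn_density_le_iff dist_norm)
qed

text \<open>In the coordinates of \<open>W1\<close> and \<open>W2\<close> both the likelihood and the parameter space are products, and the
second factor of the parameter space is the whole space. A joint maximiser thus maximises each positive factor
separately, and the second factor is maximal only at \<open>W2\<close> itself.\<close>

lemma is_theta1_mle_iff:
  fixes A :: "(real ^ 'p::finite) set"
  assumes pos: "\<sigma>1 > 0" "\<sigma>2 > 0" and r: "r = \<sigma>2\<^sup>2 / \<sigma>1\<^sup>2"
  shows "is_theta1_mle \<sigma>1 \<sigma>2 A x t \<longleftrightarrow> (\<exists>m. is_mu1_mle \<sigma>1 r A (W1 r x) m \<and> t = W2 r x + m)"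
proof -
  let ?L = "\<lambda>\<theta>. mvn_density (fst \<theta>) (\<sigma>1\<^sup>2) (fst x) * mvn_density (snd \<theta>) (\<sigma>2\<^sup>2) (snd x)"
  let ?L1 = "\<lambda>\<mu>. mvn_density \<mu> (\<sigma>1\<^sup>2 / (1 + r)) (W1 r x)"
  let ?L2 = "\<lambda>\<mu>. mvn_density \<mu> (\<sigma>2\<^sup>2 / (1 + r)) (W2 r x)"
  have r0: "r > 0" using pos by (simp add: r)
  have v: "\<sigma>1\<^sup>2 / (1 + r) > 0" "\<sigma>2\<^sup>2 / (1 + r) > 0" using pos r0 by auto
  have L_pos: "0 < ?L1 \<mu>" "0 < ?L2 \<mu>" for \<mu>
    using v by (auto intro: mvn_density_pos)
  have mu1: "mu1 r \<theta> = W1 r \<theta>" for \<theta> :: "'p pair" by (simp add: mu1_def W1_def)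
  have in_A: "\<theta> \<in> param_space A \<longleftrightarrow> (1 + r) *\<^sub>R W1 r \<theta> \<in> A" for \<theta>
    using r0 by (simp add: param_space_def W1_def)
  have L_le: "?L \<theta> \<le> ?L \<theta>' \<longleftrightarrow> ?L1 (W1 r \<theta>) * ?L2 (W2 r \<theta>) \<le> ?L1 (W1 r \<theta>') * ?L2 (W2 r \<theta>')"
    for \<theta> \<theta>' :: "'p pair"
  proof -
    have "0 < (1 + r) ^ CARD('p)" using r0 by simp
    then have "?L \<theta> \<le> ?L \<theta>' \<longleftrightarrow> (1 + r) ^ CARD('p) * ?L \<theta> \<le> (1 + r) ^ CARD('p) * ?L \<theta>'"
      by (rule mult_le_cancel_left_pos[symmetric])
    then show ?thesis unfolding likelihood_factorization[OF pos r] mu1 .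
  qed
  show ?thesis
  proof
    assume "is_theta1_mle \<sigma>1 \<sigma>2 A x t"
    then obtain t2 where t: "(t, t2) \<in> param_space A"
      and max: "\<And>\<theta>. \<theta> \<in> param_space A \<Longrightarrow> ?L \<theta> \<le> ?L (t, t2)"
      unfolding is_theta1_mle_def is_arg_max_linorder by auto
    define m where "m = W1 r (t, t2)"
    have m: "(1 + r) *\<^sub>R m \<in> A" using t in_A m_def by simp
    have max': "?L1 \<mu> * ?L2 \<nu> \<le> ?L1 m * ?L2 (W2 r (t, t2))" if "(1 + r) *\<^sub>R \<mu> \<in> A" for \<mu> \<nu>
      using max[of "(\<mu> + \<nu>, \<nu> - r *\<^sub>R \<mu>)"] that
      unfolding L_le in_A W_inverse(3,4)[OF r0] m_def by simp
    have "?L2 (W2 r x) \<le> ?L2 (W2 r (t, t2))"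
      using max'[OF m, of "W2 r x"] L_pos(1)[of m] by simp
    then have W2_eq: "W2 r (t, t2) = W2 r x"
      using v by (simp add: mvn_density_le_iff)
    have "is_mu1_mle \<sigma>1 r A (W1 r x) m"
      unfolding is_mu1_mle_def is_arg_max_linorder
      using m max'[of _ "W2 r x"] L_pos(2)[of "W2 r x"] by (simp add: W2_eq)
    moreover have "t = W2 r x + m"
      using W_inverse(1)[OF r0, of "(t, t2)"] by (simp add: m_def W2_eq add.commute)
    ultimately show "\<exists>m. is_mu1_mle \<sigma>1 r A (W1 r x) m \<and> t = W2 r x + m" by blast
  next
    assume "\<exists>m. is_mu1_mle \<sigma>1 r A (W1 r x) m \<and> t = W2 r x + m"
    then obtain m where m: "(1 + r) *\<^sub>R m \<in> A"
      and max: "\<And>\<mu>. (1 + r) *\<^sub>R \<mu> \<in> A \<Longrightarrow> ?L1 \<mu> \<le> ?L1 m" and t: "t = m + W2 r x"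
      unfolding is_mu1_mle_def is_arg_max_linorder by (auto simp: add.commute)
    let ?\<theta> = "(m + W2 r x, W2 r x - r *\<^sub>R m)"
    have "?\<theta> \<in> param_space A"
      using m unfolding in_A W_inverse(3)[OF r0] .
    moreover have "?L \<theta> \<le> ?L ?\<theta>" if "\<theta> \<in> param_space A" for \<theta>
    proof -
      have "?L1 (W1 r \<theta>) \<le> ?L1 m" using max that in_A by simp
      moreover have "?L2 (W2 r \<theta>) \<le> ?L2 (W2 r x)" using v by (simp add: mvn_density_le_iff)
      ultimately show ?thesis
        unfolding L_le W_inverse(3,4)[OF r0] using L_pos by (intro mult_mono) (auto intro: less_imp_le)
    qed
    ultimately show "is_theta1_mle \<sigma>1 \<sigma>2 A x t"
      unfolding is_theta1_mle_def is_arg_max_linorder t by blast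
  qed
qed

section \<open>Almost everywhere uniqueness of the nearest point\<close>

text \<open>Adding the two minimality inequalities cancels all squared norms. The inequality reflects that
nearest points are subgradients of the convex function \<open>w \<mapsto> sup {w \<bullet> a - |a|\<^sup>2 / 2 | a \<in> S}\<close>.\<close>

lemma nearest_point_monotone:
  fixes a b u w :: "'a::real_inner"
  assumes "nearest_point S u a" "nearest_point S w b"
  shows "0 \<le> (w - u) \<bullet> (b - a)"
proof -
  have "dist u a \<le> dist u b" "dist w b \<le> dist w a"
    using assms by (auto simp: nearest_point_def)
  then have "(norm (u - a))\<^sup>2 \<le> (norm (u - b))\<^sup>2" "(norm (w - b))\<^sup>2 \<le> (norm (w - a))\<^sup>2"
    by (auto simp: dist_norm intro: power_mono)
  then show ?thesis
    by (simp add: power2_norm_eq_inner inner_simps inner_commute)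
qed

text \<open>By monotonicity the open intervals between the components of \<open>f t\<close> and \<open>g t\<close> along \<open>d\<close> are pairwise disjoint
for different \<open>t\<close>, so a rational number chosen in each nonempty one determines \<open>t\<close>.\<close>

lemma countable_nonunique_nearest_point_on_line:
  fixes f g :: "real \<Rightarrow> 'a::real_inner"
  assumes f: "\<And>t. nearest_point S (w + t *\<^sub>R d) (f t)"
    and g: "\<And>t. nearest_point S (w + t *\<^sub>R d) (g t)"
  shows "countable {t. f t \<bullet> d \<noteq> g t \<bullet> d}"
proof -
  let ?T = "{t. f t \<bullet> d \<noteq> g t \<bullet> d}"
  have mono: "a \<bullet> d \<le> b \<bullet> d"
    if "s < t" "nearest_point S (w + s *\<^sub>R d) a" "nearest_point S (w + t *\<^sub>R d) b" for s t a b
  proof -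
    have "0 \<le> (t - s) * (d \<bullet> (b - a))"
      using nearest_point_monotone[OF that(2,3)] by (simp add: scaleR_diff_left[symmetric])
    then show ?thesis
      using that(1) by (simp add: zero_le_mult_iff inner_diff_right inner_commute)
  qed
  have "\<exists>q\<in>\<rat>. min (f t \<bullet> d) (g t \<bullet> d) < q \<and> q < max (f t \<bullet> d) (g t \<bullet> d)" if "t \<in> ?T" for t
    using that by (intro Rats_dense_in_real) auto
  then have "\<forall>t\<in>?T. \<exists>q. q \<in> \<rat> \<and> min (f t \<bullet> d) (g t \<bullet> d) < q \<and> q < max (f t \<bullet> d) (g t \<bullet> d)"
    by blast
  from bchoice[OF this] obtain q where q: "\<And>t. t \<in> ?T \<Longrightarrow> q t \<in> \<rat>"
    "\<And>t. t \<in> ?T \<Longrightarrow> min (f t \<bullet> d) (g t \<bullet> d) < q t"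
    "\<And>t. t \<in> ?T \<Longrightarrow> q t < max (f t \<bullet> d) (g t \<bullet> d)"
    by blast
  have q_less: "q s < q t" if "s < t" "s \<in> ?T" "t \<in> ?T" for s t
  proof -
    have "max (f s \<bullet> d) (g s \<bullet> d) \<le> min (f t \<bullet> d) (g t \<bullet> d)"
      using mono[OF that(1) f f] mono[OF that(1) f g] mono[OF that(1) g f] mono[OF that(1) g g]
      by simp
    then show ?thesis using q(3)[OF that(2)] q(2)[OF that(3)] by linarith
  qed
  have "inj_on q ?T"
  proof (rule inj_onI)
    fix s t assume "s \<in> ?T" "t \<in> ?T" "q s = q t"
    then show "s = t"
      using q_less[of s t] q_less[of t s] by (cases s t rule: linorder_cases) simp_all
  qed
  moreover have "countable (q ` ?T)"
    using q(1) by (intro countable_subset[OF _ countable_rat]) auto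
  ultimately show ?thesis by (rule countable_image_inj_on[rotated])
qed

text \<open>Translates of \<open>N\<close> by \<open>t d\<close> all have the same measure. Averaging over \<open>t\<close> in the unit interval and
exchanging the integrals instead measures, for each \<open>x\<close>, a countable set of parameters \<open>t\<close>. This works in
any direction without choosing coordinates adapted to \<open>d\<close>.\<close>

lemma null_set_if_countable_on_lines:
  fixes N :: "'a::euclidean_space set"
  assumes N[measurable]: "N \<in> sets borel" and lines: "\<And>x. countable {t. x + t *\<^sub>R d \<in> N}"
  shows "emeasure lborel N = 0"
proof -
  have "emeasure lborel N = (\<integral>\<^sup>+t. indicator {0..1} t * emeasure lborel N \<partial>(lborel :: real measure))"
    by (simp add: nn_integral_multc)
  also have "\<dots> = (\<integral>\<^sup>+t. (\<integral>\<^sup>+x. indicator {0..1} t * indicator N (x + t *\<^sub>R d) \<partial>lborel) \<partial>lborel)"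
  proof (rule nn_integral_cong)
    fix t :: real
    have "emeasure lborel N = (\<integral>\<^sup>+x. indicator N x \<partial>lborel)" by simp
    also have "\<dots> = (\<integral>\<^sup>+x. indicator N (x + t *\<^sub>R d) \<partial>lborel)"
      by (subst nn_integral_lborel_affine[where k = 1 and t = "t *\<^sub>R d"]) (simp_all add: add.commute)
    finally show "indicator {0..1} t * emeasure lborel N
        = (\<integral>\<^sup>+x. indicator {0..1} t * indicator N (x + t *\<^sub>R d) \<partial>lborel)"
      by (simp add: nn_integral_cmult)
  qed
  also have "\<dots> = (\<integral>\<^sup>+x. (\<integral>\<^sup>+t. indicator {0..1} t * indicator N (x + t *\<^sub>R d) \<partial>lborel) \<partial>lborel)"
    by (rule lborel_pair.Fubini') simp
  also have "\<dots> = 0"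
  proof -
    have "(\<integral>\<^sup>+t. indicator {0..1} t * indicator N (x + t *\<^sub>R d) \<partial>lborel) = 0" for x
    proof -
      have "AE t in lborel. t \<notin> {t. x + t *\<^sub>R d \<in> N}"
        using countable_imp_null_set_lborel[OF lines] by (rule AE_not_in)
      then have "AE t in lborel. indicator {0..1} t * indicator N (x + t *\<^sub>R d) = (0 :: ennreal)"
        by eventually_elim (simp add: indicator_def)
      then show ?thesis by (subst nn_integral_cong_AE[of _ "\<lambda>_. 0"]) simp_all
    qed
    then show ?thesis by simp
  qed
  finally show ?thesis .
qed

text \<open>Both \<open>\<theta>mle - W2\<close> and \<open>\<mu>mle (W1)\<close> are nearest points to \<open>W1\<close>. Moving the first observation along a
basis vector \<open>e\<close> moves \<open>W1\<close> along a multiple of \<open>e\<close>, so for each \<open>e\<close> the observations where the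
\<open>e\<close>-components disagree form a null set.\<close>

lemma AE_theta1_mle_eq:
  fixes A :: "(real ^ 'p::finite) set"
  assumes pos: "\<sigma>1 > 0" "\<sigma>2 > 0" and r: "r = \<sigma>2\<^sup>2 / \<sigma>1\<^sup>2"
    and meas: "\<theta>mle \<in> borel_measurable borel" "\<mu>mle \<in> borel_measurable borel"
    and \<theta>mle: "\<And>x. is_theta1_mle \<sigma>1 \<sigma>2 A x (\<theta>mle x)" and \<mu>mle: "\<And>w. is_mu1_mle \<sigma>1 r A w (\<mu>mle w)"
  shows "AE x in X_law \<sigma>1 \<sigma>2 \<theta>. \<theta>mle x = W2 r x + \<mu>mle (W1 r x)"
proof -
  let ?S = "{\<mu>. (1 + r) *\<^sub>R \<mu> \<in> A}"
  have r0: "r > 0" using pos by (simp add: r)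
  have [measurable]: "\<theta>mle \<in> borel_measurable borel" "\<mu>mle \<in> borel_measurable borel"
    "W1 r \<in> borel_measurable (borel :: 'p pair measure)" "W2 r \<in> borel_measurable (borel :: 'p pair measure)"
    using meas W_measurable[of r] by (simp_all add: borel_prod)
  let ?a = "\<lambda>x. \<theta>mle x - W2 r x" and ?b = "\<lambda>x. \<mu>mle (W1 r x)"
  have a: "nearest_point ?S (W1 r x) (?a x)" for x
    using \<theta>mle[of x] unfolding is_theta1_mle_iff[OF pos r] is_mu1_mle_iff_nearest_point[OF pos(1) r0]
    by auto
  have b: "nearest_point ?S (W1 r x) (?b x)" for x
    using \<mu>mle[of "W1 r x"] unfolding is_mu1_mle_iff_nearest_point[OF pos(1) r0] .
  have "AE x in lborel. ?a x \<bullet> e = ?b x \<bullet> e" if "e \<in> Basis" for e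
  proof -
    let ?N = "{x. ?a x \<bullet> e \<noteq> ?b x \<bullet> e}" and ?d = "(1 / (1 + r)) *\<^sub>R e"
    have "countable {t. x + t *\<^sub>R (e, 0) \<in> ?N}" for x
    proof -
      have shift: "W1 r (x + t *\<^sub>R (e, 0)) = W1 r x + t *\<^sub>R ?d" for t
        by (simp add: W1_def algebra_simps)
      have "countable {t. ?a (x + t *\<^sub>R (e, 0)) \<bullet> ?d \<noteq> ?b (x + t *\<^sub>R (e, 0)) \<bullet> ?d}"
        using a[of "x + _ *\<^sub>R (e, 0)"] b[of "x + _ *\<^sub>R (e, 0)"] unfolding shift
        by (intro countable_nonunique_nearest_point_on_line[of ?S "W1 r x"]) auto
      then show ?thesis using r0 by (simp add: shift)
    qed
    then have "emeasure lborel ?N = 0"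
      by (intro null_set_if_countable_on_lines[of _ "(e, 0)"]) measurable
    then show ?thesis
      by (intro AE_I[of _ _ ?N]) auto
  qed
  then have "AE x in lborel. \<forall>e\<in>Basis. ?a x \<bullet> e = ?b x \<bullet> e"
    by (intro AE_finite_allI) auto
  then have "AE x in lborel \<Otimes>\<^sub>M lborel. \<theta>mle x = W2 r x + \<mu>mle (W1 r x)"
    unfolding lborel_prod
    by eventually_elim (metis add.commute diff_add_cancel euclidean_eqI)
  then show ?thesis
    unfolding X_law_density[OF pos] by (subst AE_density) auto
qed

section \<open>Expansion of the maximum likelihood density\<close>

text \<open>The triangle inequality bounds the distance from the nearest point of \<open>w\<close> to any \<open>\<mu>\<close> of the set by
twice the distance from \<open>w\<close> to \<open>\<mu>\<close>, whose second moment is finite.\<close>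

lemma inf_mse_mle_finite:
  fixes A :: "(real ^ 'p::finite) set"
  assumes \<sigma>1: "\<sigma>1 > 0" and r: "r > 0" and A: "A \<noteq> {}"
    and \<mu>mle: "\<And>w. is_mu1_mle \<sigma>1 r A w (\<mu>mle w)"
  shows "inf_mse \<sigma>1 r A \<mu>mle < \<infinity>"
proof -
  let ?v = "\<sigma>1\<^sup>2 / (1 + r)"
  have v: "?v > 0" using \<sigma>1 r by simp
  obtain a where "a \<in> A" using A by auto
  define \<mu> where "\<mu> = (1 / (1 + r)) *\<^sub>R a"
  have \<mu>: "(1 + r) *\<^sub>R \<mu> \<in> A" using \<open>a \<in> A\<close> r by (simp add: \<mu>_def)
  have bound: "(norm (\<mu>mle w - \<mu>))\<^sup>2 \<le> 4 * (norm (w - \<mu>))\<^sup>2" for w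
  proof -
    have "dist w (\<mu>mle w) \<le> dist w \<mu>"
      using \<mu>mle[of w] \<mu> unfolding is_mu1_mle_iff_nearest_point[OF \<sigma>1 r] nearest_point_def by simp
    then have "norm (\<mu>mle w - \<mu>) \<le> 2 * norm (w - \<mu>)"
      using dist_triangle2[of "\<mu>mle w" \<mu> w] by (simp add: dist_norm norm_minus_commute)
    then have "(norm (\<mu>mle w - \<mu>))\<^sup>2 \<le> (2 * norm (w - \<mu>))\<^sup>2" by (intro power_mono) auto
    then show ?thesis by (simp add: power_mult_distrib)
  qed
  have "inf_mse \<sigma>1 r A \<mu>mle \<le> mse \<sigma>1 r \<mu>mle \<mu>"
    unfolding inf_mse_eq using \<mu> by (intro INF_lower) simp
  also have "\<dots> \<le> (\<integral>\<^sup>+w. ennreal 4 * ennreal ((norm (w - \<mu>))\<^sup>2) \<partial>mvn \<mu> ?v)"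
    unfolding mse_def using bound
    by (intro nn_integral_mono) (simp add: ennreal_mult[symmetric] ennreal_leI del: ennreal_numeral)
  also have "\<dots> = ennreal 4 * ennreal (real CARD('p) * ?v)"
    using nn_integral_mvn_norm2[OF v, of \<mu> \<mu>] by (simp add: nn_integral_cmult del: ennreal_numeral)
  also have "\<dots> < \<infinity>" by (simp add: ennreal_mult_less_top)
  finally show ?thesis .
qed

lemma dominates_cong:
  assumes "\<And>\<theta>. \<theta> \<in> param_space A \<Longrightarrow> AE x in X_law \<sigma>1 \<sigma>2 \<theta>. \<delta> x = \<delta>' x"
  shows "dominates \<sigma>1 \<sigma>2 \<sigma>Y A (q_pred \<sigma>Y \<delta> c) (q_pred \<sigma>Y \<delta> c')
    \<longleftrightarrow> dominates \<sigma>1 \<sigma>2 \<sigma>Y A (q_pred \<sigma>Y \<delta>' c) (q_pred \<sigma>Y \<delta>' c')"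
proof -
  have "kl_risk \<sigma>1 \<sigma>2 \<sigma>Y (q_pred \<sigma>Y \<delta> c) \<theta> = kl_risk \<sigma>1 \<sigma>2 \<sigma>Y (q_pred \<sigma>Y \<delta>' c) \<theta>"
    if "\<theta> \<in> param_space A" for \<theta> c
    unfolding kl_risk_def
    by (rule nn_integral_cong_AE) (use assms[OF that] in \<open>eventually_elim, simp add: q_pred_def\<close>)
  then show ?thesis by (simp add: dominates_def)
qed

theorem corollary3p1:
  fixes \<sigma>1 \<sigma>2 \<sigma>Y r :: real
    and A :: "(real ^ 'p::finite) set"
  assumes "\<sigma>1 > 0" and "\<sigma>2 > 0" and "\<sigma>Y > 0"
    and "A \<noteq> {}"
    and "r = \<sigma>2\<^sup>2 / \<sigma>1\<^sup>2"
  shows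
    "(\<forall>\<psi> \<in> borel_measurable borel. inf_mse \<sigma>1 r A \<psi> < \<infinity> \<longrightarrow>
        (\<forall>c. 1 < c \<and> c < c0 (1 + R_low \<sigma>1 \<sigma>2 \<sigma>Y A \<psi>) \<longrightarrow>
           dominates \<sigma>1 \<sigma>2 \<sigma>Y A (q_pred \<sigma>Y (delta r \<psi>) c) (q_pred \<sigma>Y (delta r \<psi>) 1)) \<and>
        c0 (1 + R_low \<sigma>1 \<sigma>2 \<sigma>Y A \<psi>) \<ge> (1 + R_low \<sigma>1 \<sigma>2 \<sigma>Y A \<psi>)\<^sup>2 \<and>
        (1 + R_low \<sigma>1 \<sigma>2 \<sigma>Y A \<psi>)\<^sup>2
          \<ge> (1 + 1 / \<sigma>Y\<^sup>2 * (\<sigma>1\<^sup>2 * \<sigma>2\<^sup>2 / (\<sigma>1\<^sup>2 + \<sigma>2\<^sup>2)))\<^sup>2) \<and>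
     (\<forall>\<theta> \<in> param_space A. distr (X_law \<sigma>1 \<sigma>2 \<theta>) borel (W1 r) = mvn (mu1 r \<theta>) (\<sigma>1\<^sup>2 / (1 + r))) \<and>
     (\<forall>x t. is_theta1_mle \<sigma>1 \<sigma>2 A x t \<longleftrightarrow>
        (\<exists>m. is_mu1_mle \<sigma>1 r A (W1 r x) m \<and> t = W2 r x + m)) \<and>
     (\<forall>\<theta>mle \<in> borel_measurable borel. \<forall>\<mu>mle \<in> borel_measurable borel.
        (\<forall>x. is_theta1_mle \<sigma>1 \<sigma>2 A x (\<theta>mle x)) \<and> (\<forall>w. is_mu1_mle \<sigma>1 r A w (\<mu>mle w)) \<longrightarrow>
        (\<forall>\<theta> \<in> param_space A. AE x in X_law \<sigma>1 \<sigma>2 \<theta>. \<theta>mle x = W2 r x + \<mu>mle (W1 r x)) \<and>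
        inf_mse \<sigma>1 r A \<mu>mle < \<infinity> \<and>
        (\<forall>c. 1 < c \<and> c < c0 (1 + R_low \<sigma>1 \<sigma>2 \<sigma>Y A \<mu>mle) \<longrightarrow>
           dominates \<sigma>1 \<sigma>2 \<sigma>Y A (q_pred \<sigma>Y \<theta>mle c) (q_pred \<sigma>Y \<theta>mle 1)) \<and>
        c0 (1 + R_low \<sigma>1 \<sigma>2 \<sigma>Y A \<mu>mle) \<ge> (1 + R_low \<sigma>1 \<sigma>2 \<sigma>Y A \<mu>mle)\<^sup>2 \<and>
        (1 + R_low \<sigma>1 \<sigma>2 \<sigma>Y A \<mu>mle)\<^sup>2
          \<ge> (1 + 1 / \<sigma>Y\<^sup>2 * (\<sigma>1\<^sup>2 * \<sigma>2\<^sup>2 / (\<sigma>1\<^sup>2 + \<sigma>2\<^sup>2)))\<^sup>2)"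
proof (intro conjI ballI allI impI; (elim conjE)?)
  note pos = assms(1-3) and r = assms(5)
  have r0: "r > 0" using pos by (simp add: r)
  show "dominates \<sigma>1 \<sigma>2 \<sigma>Y A (q_pred \<sigma>Y (delta r \<psi>) c) (q_pred \<sigma>Y (delta r \<psi>) 1)"
    if "\<psi> \<in> borel_measurable borel" "inf_mse \<sigma>1 r A \<psi> < \<infinity>"
      "1 < c" "c < c0 (1 + R_low \<sigma>1 \<sigma>2 \<sigma>Y A \<psi>)" for \<psi> c
    using delta_dominates[OF pos r that] .
  show "distr (X_law \<sigma>1 \<sigma>2 \<theta>) borel (W1 r) = mvn (mu1 r \<theta>) (\<sigma>1\<^sup>2 / (1 + r))" for \<theta> :: "'p pair"
    by (rule distr_W1[OF pos(1,2) r])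
  show "is_theta1_mle \<sigma>1 \<sigma>2 A x t \<longleftrightarrow> (\<exists>m. is_mu1_mle \<sigma>1 r A (W1 r x) m \<and> t = W2 r x + m)" for x t
    by (rule is_theta1_mle_iff[OF pos(1,2) r])
  fix \<theta>mle :: "'p pair \<Rightarrow> real ^ 'p" and \<mu>mle :: "real ^ 'p \<Rightarrow> real ^ 'p"
  assume meas: "\<theta>mle \<in> borel_measurable borel" "\<mu>mle \<in> borel_measurable borel"
    and mle: "\<forall>x. is_theta1_mle \<sigma>1 \<sigma>2 A x (\<theta>mle x)" "\<forall>w. is_mu1_mle \<sigma>1 r A w (\<mu>mle w)"
  show AE_eq: "AE x in X_law \<sigma>1 \<sigma>2 \<theta>. \<theta>mle x = W2 r x + \<mu>mle (W1 r x)" for \<theta>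
    using AE_theta1_mle_eq[OF pos(1,2) r meas] mle by blast
  show finite: "inf_mse \<sigma>1 r A \<mu>mle < \<infinity>"
    using inf_mse_mle_finite[OF pos(1) r0 assms(4)] mle(2) by blast
  show "dominates \<sigma>1 \<sigma>2 \<sigma>Y A (q_pred \<sigma>Y \<theta>mle c) (q_pred \<sigma>Y \<theta>mle 1)"
    if "1 < c" "c < c0 (1 + R_low \<sigma>1 \<sigma>2 \<sigma>Y A \<mu>mle)" for c
    using delta_dominates[OF pos r meas(2) finite that] AE_eq
      dominates_cong[where \<delta> = \<theta>mle and \<delta>' = "delta r \<mu>mle" and A = A]
    by (simp add: delta_def)
qed (rule R_low_bounds(2,3)[OF assms(1-3)])+

end
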